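(* Let $M, N$ be terms such that $M \triangleright^* N$. Then there exists a standard reduction sequence $M_1;\ldots;M_n$ with $M_1 = M$ and $M_n = N$.
   Context: **Syntax.** Fix two disjoint countably infinite sets of symbols: variables $x,y,z,\dots$ and constants $a,b,c,\dots$. Terms: $M,N ::= x \mid c \mid \lambda p.M \mid MM$. Data terms: $D ::= c \mid DM$. Patterns: $p,q ::= x \mid d$. Data patterns: $d ::= c \mid dp$. (Patterns need not be linear.) In $\lambda p.M$ all variables of $p$ are bound in $M$; terms are taken modulo $\alpha$-conversion. A substitution is a function $\theta$ from variables to terms with finite domain $\mathrm{dom}(\theta)=\{x : \theta(x)\neq x\}$; it extends (capture-avoiding) to terms, written $\theta M$. **Matching.** For a pattern $p$ and a term $M$ sharing no variables, the judgment $p \ll^{\theta} M$ ($p$ matches $M$ with resulting substitution $\theta$) is defined by: $x \ll^{\{x/N\}} N$; $c \ll^{\emptyset} c$; if $d \ll^{\theta_1} D$, $p \ll^{\theta_2} N$ and $\mathrm{dom}(\theta_1)\cap\mathrm{dom}(\theta_2)=\emptyset$ then $dp \ll^{\theta_1\uplus\theta_2} DN$ (with $\uplus$ the union of substitutions with disjoint domains). Write $p\ll M$ if $p\ll^\theta M$ for some $\theta$, and $p\not\ll M$ otherwise. In a term $(\lambda p.M)N$ the variables of $p$ are always assumed, by $\alpha$-conversion, not to occur free in $N$. **Development.** $\triangleright$ on terms is the least relation, defined together with $\blacktriangleright$ on substitutions, such that: $M\triangleright M$; if $M\triangleright M'$ then $\lambda p.M\triangleright\lambda p.M'$; if $M\triangleright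 M'$ and $N\triangleright N'$ then $MN\triangleright M'N'$; if $M\triangleright M'$, $p\ll^\theta N$ and $\theta\blacktriangleright\theta'$ then $(\lambda p.M)N\triangleright\theta'M'$. Here $\theta\blacktriangleright\theta'$ iff $\mathrm{dom}(\theta)=\mathrm{dom}(\theta')$ and $\theta x\triangleright\theta' x$ for all $x\in\mathrm{dom}(\theta)$. $\triangleright^*$ is the reflexive-transitive closure of $\triangleright$. **Head steps.** The relations $\to_h$ and, for each pattern $p$, $\rightsquigarrow_p$ on terms are the least relations such that: - if $M\to_h M'$ then $MN\to_h M'N$; - if $p\ll^\theta N$ then $(\lambda p.M)N\to_h\theta M$; - if $N\rightsquigarrow_p N'$ then $(\lambda p.M)N\to_h(\lambda p.M)N'$; - if $M\to_h M'$ then $M\rightsquigarrow_d M'$ for every data pattern $d$; - if $D\rightsquigarrow_d D'$ with $D,D'$ data terms then $DM\rightsquigarrow_{dp}D'M$; - if $M\rightsquigarrow_p M'$ and $d\ll D$, with $D$ a data term, then $DM\rightsquigarrow_{dp}DM'$. **Standard reduction sequences** are the finite sequences of terms generated by the rules: - (StdVar) for every variable $x$ and every constant $c$, the one-element sequences $x$ and $c$ are standard; - (StdHead) if $M_2;\ldots;M_k$ is standard and $M_1\to_h M_2$, then $M_1;M_2;\ldots;M_k$ is standard; - (StdAbs) if $M_1;\ldots;M_k$ is standard, then $\lambda p.M_1;\ldots;\lambda p.M_k$ is standard; - (StdApp) if $M_1;\ldots;M_j$ and $N_1;\ldots;N_k$ are standard, then $(M_1N_1);\ldots;(M_jN_1);(M_jN_2);\ldots;(M_jN_k)$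 is standard. *)

theory Defs
  imports Main
begin

type_synonym var = nat
type_synonym con = nat

datatype 'v pat = PVar 'v | PData "'v dpat"
  and 'v dpat = PCon con | PApp "'v dpat" "'v pat"

abbreviation pvars :: "'v pat \<Rightarrow> 'v set" where
  "pvars \<equiv> set_pat"

datatype 'v rtrm = RVar 'v | RCon con | RLam "'v pat" "'v rtrm" | RApp "'v rtrm" "'v rtrm"

primrec rfv :: "'v rtrm \<Rightarrow> 'v set" where
  "rfv (RVar x) = {x}"
| "rfv (RCon c) = {}"
| "rfv (RLam p M) = rfv M - pvars p"
| "rfv (RApp M N) = rfv M \<union> rfv N"

text \<open>\<open>\<alpha>\<close>-conversion: the variables of a binder are renamed by a bijection of the variables that fixes the free variables of the
  abstraction. \<open>map_rtrm f\<close> renames all variables (free, bound and binding), so it is the action of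
  the bijection and cannot capture.\<close>

inductive alpha :: "'v rtrm \<Rightarrow> 'v rtrm \<Rightarrow> bool" where
  alpha_Var: "alpha (RVar x) (RVar x)"
| alpha_Con: "alpha (RCon c) (RCon c)"
| alpha_Lam: "bij f \<Longrightarrow> \<forall>x \<in> rfv M - pvars p. f x = x \<Longrightarrow> alpha (map_rtrm f M) N
    \<Longrightarrow> alpha (RLam p M) (RLam (map_pat f p) N)"
| alpha_App: "alpha M M' \<Longrightarrow> alpha N N' \<Longrightarrow> alpha (RApp M N) (RApp M' N')"

lemma finite_pvars [simp]:
  fixes p :: "'v pat" and d :: "'v dpat"
  shows "finite (set_pat p)" "finite (set_dpat d)"
  by (induction p and d) auto

lemma finite_rfv [simp]: "finite (rfv M)"
  by (induction M) auto

lemma rfv_map: "bij f \<Longrightarrow> rfv (map_rtrm f M) = f ` rfv M"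
  by (induction M) (auto simp: pat.set_map bij_def image_set_diff image_Un)

lemma map_rtrm_o: "map_rtrm f (map_rtrm g M) = map_rtrm (\<lambda>x. f (g x)) M"
  by (simp add: rtrm.map_comp comp_def)

lemma map_pat_o: "map_pat f (map_pat g M) = map_pat (\<lambda>x. f (g x)) M"
  by (simp add: pat.map_comp comp_def)

lemma map_rtrm_idI: "(\<And>x. f x = x) \<Longrightarrow> map_rtrm f M = M"
  using rtrm.map_ident by (metis rtrm.map_cong0)

lemma map_pat_idI: "(\<And>x. f x = x) \<Longrightarrow> map_pat f M = M"
  using pat.map_ident by (metis pat.map_cong0)

lemma alpha_LamI: "bij f \<Longrightarrow> \<forall>x \<in> rfv M - pvars p. f x = x \<Longrightarrow> alpha (map_rtrm f M) N
    \<Longrightarrow> q = map_pat f p \<Longrightarrow> alpha (RLam p M) (RLam q N)"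
  using alpha_Lam by metis

lemma alpha_refl: "alpha M M"
proof (induction M)
  case (RLam p M)
  then show ?case by (intro alpha_LamI[where f=id]) (simp_all add: rtrm.map_id pat.map_id)
qed (simp_all add: alpha_Var alpha_Con alpha_App)

lemma alpha_rfv: "alpha M N \<Longrightarrow> rfv M = rfv N"
proof (induction rule: alpha.induct)
  case (alpha_Lam f M p N)
  have "rfv N - pvars (map_pat f p) = f ` (rfv M - pvars p)"
    unfolding alpha_Lam.IH[symmetric] rfv_map[OF alpha_Lam.hyps(1)] pat.set_map
    using alpha_Lam.hyps(1) by (simp add: image_set_diff bij_is_inj)
  also have "\<dots> = rfv M - pvars p" using alpha_Lam.hyps(2) by force
  finally show ?case by simp
qed auto

lemma alpha_map: "alpha M N \<Longrightarrow> bij g \<Longrightarrow> alpha (map_rtrm g M) (map_rtrm g N)"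
proof (induction rule: alpha.induct)
  case (alpha_Lam f M p N)
  let ?h = "g \<circ> f \<circ> inv g"
  have ig: "inv g (g x) = x" for x using alpha_Lam(5) by (simp add: bij_def)
  show ?case
    unfolding rtrm.map
  proof (rule alpha_LamI[where f="?h"])
    show "bij ?h" using alpha_Lam.hyps(1) alpha_Lam.prems by (intro bij_comp bij_imp_bij_inv)
    show "\<forall>x\<in>rfv (map_rtrm g M) - pvars (map_pat g p). ?h x = x"
    proof
      fix x assume "x \<in> rfv (map_rtrm g M) - pvars (map_pat g p)"
      then obtain y where "x = g y" "y \<in> rfv M - pvars p"
        unfolding rfv_map[OF alpha_Lam.prems] pat.set_map by blast
      then show "?h x = x" using alpha_Lam.hyps(2) by (simp add: ig)
    qed
    show "alpha (map_rtrm ?h (map_rtrm g M)) (map_rtrm g N)"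
      using alpha_Lam.IH[OF alpha_Lam.prems] by (simp add: map_rtrm_o ig)
    show "map_pat g (map_pat f p) = map_pat ?h (map_pat g p)"
      by (simp add: map_pat_o ig)
  qed
qed (simp_all add: alpha_Var alpha_Con alpha_App)

lemma alpha_sym: "alpha M N \<Longrightarrow> alpha N M"
proof (induction rule: alpha.induct)
  case (alpha_Lam f M p N)
  have iv: "inv f (f x) = x" for x using alpha_Lam(1) by (simp add: bij_def)
  have fv: "rfv N = f ` rfv M" using alpha_rfv[OF alpha_Lam(3)] alpha_Lam(1) by (simp add: rfv_map)
  show ?case
  proof (rule alpha_LamI[where f="inv f"])
    show "bij (inv f)" using alpha_Lam.hyps(1) by (rule bij_imp_bij_inv)
    show "\<forall>x\<in>rfv N - pvars (map_pat f p). inv f x = x"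
    proof
      fix x assume "x \<in> rfv N - pvars (map_pat f p)"
      then obtain y where "x = f y" "y \<in> rfv M - pvars p"
        unfolding fv pat.set_map by blast
      then show "inv f x = x" using alpha_Lam.hyps(2) iv[of y] by simp
    qed
    show "alpha (map_rtrm (inv f) N) M"
      using alpha_map[OF alpha_Lam(4) \<open>bij (inv f)\<close>] by (simp add: map_rtrm_o iv map_rtrm_idI)
    show "p = map_pat (inv f) (map_pat f p)"
      by (simp add: map_pat_o iv map_pat_idI)
  qed
qed (simp_all add: alpha_Var alpha_Con alpha_App)

inductive_cases alpha_VarE: "alpha (RVar x) N"
inductive_cases alpha_ConE: "alpha (RCon x) N"
inductive_cases alpha_LamE: "alpha (RLam p M) N"
inductive_cases alpha_AppE: "alpha (RApp M M') N"

lemma alpha_trans: "alpha M N \<Longrightarrow> alpha N P \<Longrightarrow> alpha M P"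
proof (induction arbitrary: P rule: alpha.induct)
  case (alpha_Lam f M p N)
  from alpha_Lam.prems obtain g N' where g: "bij g"
    "\<forall>x \<in> rfv N - pvars (map_pat f p). g x = x" "alpha (map_rtrm g N) N'"
    "P = RLam (map_pat g (map_pat f p)) N'"
    by (auto elim: alpha_LamE)
  have fv: "rfv N = f ` rfv M"
    using alpha_rfv[OF alpha_Lam(3)] alpha_Lam(1) by (simp add: rfv_map)
  have inv: "alpha (map_rtrm (inv g) N') N"
    using alpha_map[OF alpha_sym[OF g(3)], of "inv g"] g(1)
    by (simp add: map_rtrm_o map_rtrm_idI bij_imp_bij_inv bij_is_inj)
  have "alpha (map_rtrm f M) (map_rtrm (inv g) N')"
    using alpha_Lam.IH alpha_sym[OF inv] .
  from alpha_map[OF this g(1)] have "alpha (map_rtrm (\<lambda>x. g (f x)) M) N'"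
    using g(1) by (simp add: map_rtrm_o map_rtrm_idI bij_is_surj surj_f_inv_f)
  then show ?case unfolding g(4)
  proof (rule alpha_LamI[rotated 2])
    show "bij (\<lambda>x. g (f x))" using bij_comp[OF alpha_Lam(1) g(1)] by (simp add: comp_def)
    show "\<forall>x\<in>rfv M - pvars p. g (f x) = x"
    proof
      fix x assume x: "x \<in> rfv M - pvars p"
      then have "f x = x" using alpha_Lam.hyps(2) by blast
      moreover have "f x \<notin> f ` pvars p" using x alpha_Lam(1) by (auto simp: bij_def inj_def)
      moreover have "f x \<in> rfv N" using x fv by blast
      ultimately show "g (f x) = x" using g(2) by (metis DiffI pat.set_map(1))
    qed
  qed (simp add: map_pat_o)
qed (auto elim!: alpha_VarE alpha_ConE alpha_AppE intro: alpha_Var alpha_Con alpha_App)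

lemma equivp_alpha: "equivp alpha"
  by (auto intro!: equivpI reflpI sympI transpI intro: alpha_refl alpha_sym alpha_trans)

text \<open>Simultaneous capture-avoiding substitution: the variables of a binder are shifted above all
  free variables of the terms that are substituted into the abstraction.\<close>

definition fresh_above :: "var set \<Rightarrow> nat" where
  "fresh_above A = Suc (Max (insert 0 A))"

primrec rsubst :: "(var \<Rightarrow> var rtrm) \<Rightarrow> var rtrm \<Rightarrow> var rtrm" where
  "rsubst \<theta> (RVar x) = \<theta> x"
| "rsubst \<theta> (RCon c) = RCon c"
| "rsubst \<theta> (RLam p M) =
     (let k = fresh_above (\<Union>y \<in> rfv M - pvars p. rfv (\<theta> y))
      in RLam (map_pat (\<lambda>x. x + k) p)
           (rsubst (\<lambda>x. if x \<in> pvars p then RVar (x + k) else \<theta> x) M))"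
| "rsubst \<theta> (RApp M N) = RApp (rsubst \<theta> M) (rsubst \<theta> N)"


lemma fresh_above: "finite A \<Longrightarrow> y \<in> A \<Longrightarrow> y < fresh_above A"
  by (simp add: fresh_above_def less_Suc_eq_le)

lemma alpha_Lam_cong: "alpha M N \<Longrightarrow> alpha (RLam p M) (RLam p N)"
  by (rule alpha_LamI[where f=id]) (auto simp: rtrm.map_id pat.map_id)

lemma alpha_map_id: "bij h \<Longrightarrow> \<forall>x \<in> rfv M. h x = x \<Longrightarrow> alpha (map_rtrm h M) M"
proof (induction M)
  case (RLam p M)
  then have "alpha (RLam p M) (RLam (map_pat h p) (map_rtrm h M))"
    by (intro alpha_LamI[where f=h]) (auto intro: alpha_refl)
  then show ?case by (auto intro: alpha_sym)
qed (simp_all add: alpha_Var alpha_Con alpha_App)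

lemma ext_bij:
  assumes "finite A" "inj_on u A" "B \<inter> (A \<union> u ` A) = {}"
  obtains h :: "'v \<Rightarrow> 'v" where "bij h" "\<forall>x \<in> A. h x = u x" "\<forall>x \<in> B. h x = x"
proof -
  let ?S = "A \<union> u ` A"
  have "card (?S - A) = card (?S - u ` A)"
    using assms by (simp add: card_Diff_subset card_image)
  then obtain w where w: "bij_betw w (?S - A) (?S - u ` A)"
    using assms(1) finite_same_card_bij by (metis finite_Diff finite_Un finite_imageI)
  define h where "h = (\<lambda>x. if x \<in> A then u x else if x \<in> ?S then w x else x)"
  have "bij_betw h A (u ` A)"
    using assms(2) by (auto simp: h_def bij_betw_def inj_on_def)
  moreover have "bij_betw h (?S - A) (?S - u ` A)"
    using w by (rule bij_betw_cong[THEN iffD1, rotated]) (auto simp: h_def)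
  ultimately have "bij_betw h (A \<union> (?S - A)) (u ` A \<union> (?S - u ` A))"
    by (rule bij_betw_combine) auto
  then have "bij_betw h ?S ?S" by (simp add: Un_Diff_cancel Un_absorb1)
  moreover have "bij_betw h (- ?S) (- ?S)" by (auto simp: h_def bij_betw_def inj_on_def)
  ultimately have "bij_betw h (?S \<union> - ?S) (?S \<union> - ?S)"
    by (rule bij_betw_combine) auto
  then have "bij h" by (simp only: Compl_partition)
  then show ?thesis using assms(3) by (intro that[of h]) (auto simp: h_def)
qed

lemma rfv_rsubst: "rfv (rsubst \<theta> M) = (\<Union>x \<in> rfv M. rfv (\<theta> x))"
proof (induction M arbitrary: \<theta>)
  case (RLam p M)
  let ?k = "fresh_above (\<Union>y \<in> rfv M - pvars p. rfv (\<theta> y))"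
  have "z < ?k" if "z \<in> rfv (\<theta> y)" "y \<in> rfv M" "y \<notin> pvars p" for y z
    using that by (auto intro!: fresh_above)
  then show ?case by (fastforce simp: Let_def RLam.IH pat.set_map split: if_splits)
qed auto

lemma rsubst_cong:
  "\<forall>x \<in> rfv M. alpha (\<theta> x) (\<theta>' x) \<Longrightarrow> alpha (rsubst \<theta> M) (rsubst \<theta>' M)"
proof (induction M arbitrary: \<theta> \<theta>')
  case (RLam p M)
  have "(\<Union>y \<in> rfv M - pvars p. rfv (\<theta> y)) = (\<Union>y \<in> rfv M - pvars p. rfv (\<theta>' y))"
    using RLam.prems by (intro SUP_cong) (auto simp: alpha_rfv)
  then show ?case using RLam.prems
    by (auto simp: Let_def intro!: alpha_Lam_cong RLam.IH intro: alpha_refl)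
qed (simp_all add: alpha_Var alpha_Con alpha_App)

lemma rsubst_Lam_alpha:
  fixes M :: "var rtrm"
  assumes eqv: "\<And>g \<sigma>. bij g \<Longrightarrow> alpha (map_rtrm g (rsubst \<sigma> M)) (rsubst (\<lambda>x. map_rtrm g (\<sigma> x)) M)"
    and inj: "inj_on f (pvars p)" "inj_on f' (pvars p)"
    and bnd: "\<forall>x \<in> pvars p. \<sigma> x = RVar (f x)" "\<forall>x \<in> pvars p. \<sigma>' x = RVar (f' x)"
    and free: "\<forall>x \<in> rfv M - pvars p. alpha (\<sigma> x) (\<sigma>' x)"
    and fresh: "\<forall>x \<in> rfv M - pvars p. rfv (\<sigma> x) \<inter> (f ` pvars p \<union> f' ` pvars p) = {}"
  shows "alpha (RLam (map_pat f p) (rsubst \<sigma> M)) (RLam (map_pat f' p) (rsubst \<sigma>' M))"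
proof -
  let ?u = "\<lambda>y. f' (inv_into (pvars p) f y)"
  let ?B = "\<Union>x \<in> rfv M - pvars p. rfv (\<sigma> x)"
  have u: "?u (f x) = f' x" if "x \<in> pvars p" for x
    using that inj(1) by simp
  then have img: "?u ` f ` pvars p = f' ` pvars p" by force
  have "finite (f ` pvars p)" by simp
  moreover have "inj_on ?u (f ` pvars p)"
    using inj(2) u by (auto simp: inj_on_def)
  moreover have "?B \<inter> (f ` pvars p \<union> ?u ` f ` pvars p) = {}"
    using fresh unfolding img by blast
  ultimately obtain h where h: "bij h" "\<forall>x \<in> f ` pvars p. h x = ?u x" "\<forall>x \<in> ?B. h x = x"
    by (rule ext_bij)
  have hp: "h (f x) = f' x" if "x \<in> pvars p" for x using that h(2) u by auto
  show ?thesis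
  proof (rule alpha_LamI[OF h(1)])
    show "\<forall>x\<in>rfv (rsubst \<sigma> M) - pvars (map_pat f p). h x = x"
    proof
      fix z assume z: "z \<in> rfv (rsubst \<sigma> M) - pvars (map_pat f p)"
      then obtain y where y: "y \<in> rfv M" "z \<in> rfv (\<sigma> y)" by (auto simp: rfv_rsubst)
      then have "y \<notin> pvars p" using z bnd(1) by (auto simp: pat.set_map)
      then show "h z = z" using h(3) y by blast
    qed
    have "alpha (map_rtrm h (\<sigma> x)) (\<sigma>' x)" if "x \<in> rfv M" for x
    proof (cases "x \<in> pvars p")
      case True
      then show ?thesis using bnd hp by (simp add: alpha_Var)
    next
      case False
      then have "alpha (map_rtrm h (\<sigma> x)) (\<sigma> x)" using that h(3) by (intro alpha_map_id[OF h(1)]) blast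
      then show ?thesis using False that free by (blast intro: alpha_trans)
    qed
    then show "alpha (map_rtrm h (rsubst \<sigma> M)) (rsubst \<sigma>' M)"
      by (intro alpha_trans[OF eqv[OF h(1)]] rsubst_cong) auto
    show "map_pat f' p = map_pat h (map_pat f p)"
      by (auto simp: pat.map_comp comp_def hp intro!: pat.map_cong0)
  qed
qed

lemma map_rsubst:
  "bij g \<Longrightarrow> alpha (map_rtrm g (rsubst \<sigma> M)) (rsubst (\<lambda>x. map_rtrm g (\<sigma> x)) M)"
proof (induction M arbitrary: g \<sigma>)
  case (RLam p M)
  let ?k = "fresh_above (\<Union>y \<in> rfv M - pvars p. rfv (\<sigma> y))"
  let ?k' = "fresh_above (\<Union>y \<in> rfv M - pvars p. rfv (map_rtrm g (\<sigma> y)))"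
  let ?s = "\<lambda>x. if x \<in> pvars p then RVar (x + ?k) else \<sigma> x"
  have injg: "g x = g y \<longleftrightarrow> x = y" for x y using RLam.prems by (auto simp: bij_def inj_def)
  have k: "z < ?k" if "z \<in> rfv (\<sigma> y)" "y \<in> rfv M" "y \<notin> pvars p" for y z
    using that by (auto intro!: fresh_above)
  have k': "z < ?k'" if "z \<in> rfv (map_rtrm g (\<sigma> y))" "y \<in> rfv M" "y \<notin> pvars p" for y z
    using that by (auto intro!: fresh_above)
  have "alpha (RLam (map_pat (\<lambda>x. g (x + ?k)) p) (map_rtrm g (rsubst ?s M)))
      (RLam (map_pat (\<lambda>x. g (x + ?k)) p) (rsubst (\<lambda>x. map_rtrm g (?s x)) M))"
    using RLam by (intro alpha_Lam_cong) auto
  also have "alpha \<dots> (rsubst (\<lambda>x. map_rtrm g (\<sigma> x)) (RLam p M))" (is "alpha ?l ?r")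
    unfolding rsubst.simps Let_def
  proof (rule rsubst_Lam_alpha[OF RLam.IH])
    show "\<forall>x\<in>rfv M - pvars p. rfv (map_rtrm g (?s x)) \<inter>
        ((\<lambda>x. g (x + ?k)) ` pvars p \<union> (\<lambda>x. x + ?k') ` pvars p) = {}"
    proof
      fix x assume x: "x \<in> rfv M - pvars p"
      have "z < ?k'" if "z \<in> rfv (map_rtrm g (\<sigma> x))" for z using k' that x by auto
      moreover have "z \<noteq> g (y + ?k)" if "z \<in> rfv (map_rtrm g (\<sigma> x))" for y z
        using k[of _ x] that x RLam.prems by (fastforce simp: rfv_map injg)
      ultimately show "rfv (map_rtrm g (?s x)) \<inter>
        ((\<lambda>x. g (x + ?k)) ` pvars p \<union> (\<lambda>x. x + ?k') ` pvars p) = {}"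
        using x by fastforce
    qed
  qed (auto simp: inj_on_def injg intro: alpha_refl)
  finally (alpha_trans) show ?case by (simp add: Let_def map_pat_o)
qed (simp_all add: alpha_refl alpha_Var alpha_Con alpha_App)

lemma rsubst_shift_alpha:
  fixes \<sigma> \<tau> :: "var \<Rightarrow> var rtrm"
  defines "k \<equiv> \<lambda>M p. fresh_above (\<Union>y \<in> rfv M - pvars p. rfv (\<sigma> y))"
  assumes "bij f" "\<forall>x \<in> rfv M - pvars p. \<tau> (f x) = \<sigma> x"
  shows "alpha
    (RLam (map_pat (\<lambda>x. f x + k M p) p)
      (rsubst (\<lambda>x. if f x \<in> pvars (map_pat f p) then RVar (f x + k M p) else \<tau> (f x)) M))
    (RLam (map_pat (\<lambda>x. x + k M p) p)
      (rsubst (\<lambda>x. if x \<in> pvars p then RVar (x + k M p) else \<sigma> x) M))"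
proof -
  have injf: "f x = f y \<longleftrightarrow> x = y" for x y using assms(2) by (auto simp: bij_def inj_def)
  then have mem: "f x \<in> pvars (map_pat f p) \<longleftrightarrow> x \<in> pvars p" for x by (auto simp: pat.set_map)
  have k: "z < k M p" if "z \<in> rfv (\<sigma> y)" "y \<in> rfv M" "y \<notin> pvars p" for y z
    using that unfolding k_def by (auto intro!: fresh_above)
  show ?thesis unfolding mem
    using assms(3) by (intro rsubst_Lam_alpha map_rsubst) (auto simp: inj_on_def injf intro: alpha_refl dest!: k)
qed

lemma rsubst_map: "bij f \<Longrightarrow> alpha (rsubst \<theta> (map_rtrm f M)) (rsubst (\<lambda>x. \<theta> (f x)) M)"
proof (induction M arbitrary: \<theta>)
  case (RLam p M)
  let ?k = "fresh_above (\<Union>y \<in> rfv M - pvars p. rfv (\<theta> (f y)))"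
  have k: "fresh_above (\<Union>y \<in> rfv (map_rtrm f M) - pvars (map_pat f p). rfv (\<theta> y)) = ?k"
    unfolding rfv_map[OF RLam.prems] pat.set_map image_set_diff[OF bij_is_inj[OF RLam.prems], symmetric]
    by simp
  have "alpha (rsubst \<theta> (map_rtrm f (RLam p M)))
    (RLam (map_pat (\<lambda>x. f x + ?k) p)
      (rsubst (\<lambda>x. if f x \<in> pvars (map_pat f p) then RVar (f x + ?k) else \<theta> (f x)) M))"
    unfolding rtrm.map rsubst.simps Let_def k map_pat_o
    using RLam.IH[OF RLam.prems] by (rule alpha_Lam_cong)
  also have "alpha \<dots> (rsubst (\<lambda>x. \<theta> (f x)) (RLam p M))" (is "alpha ?l ?r")
    unfolding rsubst.simps Let_def by (rule rsubst_shift_alpha) (use RLam.prems in auto)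
  finally (alpha_trans) show ?case .
qed (simp_all add: alpha_refl alpha_Var alpha_Con alpha_App)

lemma rsubst_alpha: "alpha M N \<Longrightarrow> alpha (rsubst \<theta> M) (rsubst \<theta> N)"
proof (induction arbitrary: \<theta> rule: alpha.induct)
  case (alpha_Lam f M p N)
  let ?k = "fresh_above (\<Union>y \<in> rfv M - pvars p. rfv (\<theta> y))"
  have "rfv (RLam p M) = rfv (RLam (map_pat f p) N)"
    using alpha.alpha_Lam[OF alpha_Lam.hyps] by (rule alpha_rfv)
  then have k: "fresh_above (\<Union>y \<in> rfv N - pvars (map_pat f p). rfv (\<theta> y)) = ?k"
    unfolding rfv.simps by simp
  let ?t = "\<lambda>x. if x \<in> pvars (map_pat f p) then RVar (x + ?k) else \<theta> x"
  have "alpha (rsubst ?t N) (rsubst (\<lambda>x. ?t (f x)) M)"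
    using alpha_sym[OF alpha_Lam.IH] rsubst_map[OF alpha_Lam.hyps(1)] by (rule alpha_trans)
  then have "alpha (rsubst \<theta> (RLam (map_pat f p) N))
    (RLam (map_pat (\<lambda>x. f x + ?k) p) (rsubst (\<lambda>x. ?t (f x)) M))"
    unfolding rsubst.simps Let_def k map_pat_o by (rule alpha_Lam_cong)
  also have "alpha \<dots> (rsubst \<theta> (RLam p M))" (is "alpha ?l ?r")
    unfolding rsubst.simps Let_def by (rule rsubst_shift_alpha) (use alpha_Lam.hyps in auto)
  finally (alpha_trans) show ?case by (rule alpha_sym)
qed (simp_all add: alpha_refl alpha_Var alpha_Con alpha_App)

quotient_type trm = "var rtrm" / alpha
  by (rule equivp_alpha)

lift_definition Var :: "var \<Rightarrow> trm" is RVar .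
lift_definition Con :: "con \<Rightarrow> trm" is RCon .
lift_definition Lam :: "var pat \<Rightarrow> trm \<Rightarrow> trm" is RLam by (rule alpha_Lam_cong)
lift_definition App :: "trm \<Rightarrow> trm \<Rightarrow> trm" (infixl "\<cdot>" 200) is RApp by (rule alpha_App)
lift_definition FV :: "trm \<Rightarrow> var set" is rfv by (rule alpha_rfv)

lift_definition subst :: "(var \<Rightarrow> trm) \<Rightarrow> trm \<Rightarrow> trm" is rsubst
  by (blast intro: alpha_trans rsubst_cong rsubst_alpha)

lemma subst_simps [simp]:
  "subst \<theta> (Var x) = \<theta> x"
  "subst \<theta> (Con c) = Con c"
  "subst \<theta> (M \<cdot> N) = subst \<theta> M \<cdot> subst \<theta> N"
  by (transfer; simp add: alpha_refl)+

lemma FV_simps [simp]: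
  "FV (Var x) = {x}"
  "FV (Con c) = {}"
  "FV (Lam p M) = FV M - pvars p"
  "FV (M \<cdot> N) = FV M \<union> FV N"
  by (transfer; simp)+

lemma subst_Lam:
  assumes "\<forall>x \<in> pvars p. \<theta> x = Var x" "\<forall>y \<in> FV M - pvars p. FV (\<theta> y) \<inter> pvars p = {}"
  shows "subst \<theta> (Lam p M) = Lam p (subst \<theta> M)"
  using assms
proof transfer
  fix p \<theta> and M :: "var rtrm"
  assume *: "\<forall>x\<in>pvars p. alpha (\<theta> x) (RVar x)" "\<forall>y\<in>rfv M - pvars p. rfv (\<theta> y) \<inter> pvars p = {}"
  let ?k = "fresh_above (\<Union>y \<in> rfv M - pvars p. rfv (\<theta> y))"
  have k: "z < ?k" if "z \<in> rfv (\<theta> y)" "y \<in> rfv M" "y \<notin> pvars p" for y z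
    using that by (auto intro!: fresh_above)
  have th: "\<theta> x = RVar x" if "x \<in> pvars p" for x
    using alpha_sym[OF bspec[OF *(1) that]] by (rule alpha_VarE) simp
  have "alpha (rsubst \<theta> (RLam p M)) (RLam (map_pat (\<lambda>x. x) p) (rsubst \<theta> M))"
    unfolding rsubst.simps Let_def
    using *(2) by (intro rsubst_Lam_alpha map_rsubst) (auto simp: th inj_on_def intro: alpha_refl dest: k)
  then show "alpha (rsubst \<theta> (RLam p M)) (RLam p (rsubst \<theta> M))"
    by (simp add: pat.map_ident)
qed

inductive data_term :: "trm \<Rightarrow> bool" where
  "data_term (Con c)"
| "data_term D \<Longrightarrow> data_term (D \<cdot> M)"

definition sdom :: "(var \<Rightarrow> trm) \<Rightarrow> var set" where
  "sdom \<theta> = {x. \<theta> x \<noteq> Var x}"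

definition sunion :: "(var \<Rightarrow> trm) \<Rightarrow> (var \<Rightarrow> trm) \<Rightarrow> var \<Rightarrow> trm" where
  "sunion \<theta>\<^sub>1 \<theta>\<^sub>2 = (\<lambda>x. if x \<in> sdom \<theta>\<^sub>1 then \<theta>\<^sub>1 x else \<theta>\<^sub>2 x)"

text \<open>\<open>matches p \<theta> M\<close> is the judgment \<open>p \<lless>\<^sup>\<theta> M\<close>. It is only defined when \<open>p\<close> and \<open>M\<close> share no
  variables, hence the disjointness premises; for terms modulo \<open>\<alpha>\<close> only the free variables of \<open>M\<close>
  are meaningful here. The resulting substitutions always have finite domain, and those related to
  them by \<open>devs\<close> as well, so finiteness need not be required.\<close>

inductive matches :: "var pat \<Rightarrow> (var \<Rightarrow> trm) \<Rightarrow> trm \<Rightarrow> bool" where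
  match_Var: "x \<notin> FV N \<Longrightarrow> matches (PVar x) (Var(x := N)) N"
| match_Con: "matches (PData (PCon c)) Var (Con c)"
| match_App: "\<lbrakk>pvars (PData (PApp d p)) \<inter> FV (D \<cdot> N) = {}; data_term D;
      matches (PData d) \<theta>\<^sub>1 D; matches p \<theta>\<^sub>2 N; sdom \<theta>\<^sub>1 \<inter> sdom \<theta>\<^sub>2 = {}\<rbrakk>
    \<Longrightarrow> matches (PData (PApp d p)) (sunion \<theta>\<^sub>1 \<theta>\<^sub>2) (D \<cdot> N)"

inductive dev :: "trm \<Rightarrow> trm \<Rightarrow> bool" (infix "\<triangleright>" 50)
  and devs :: "(var \<Rightarrow> trm) \<Rightarrow> (var \<Rightarrow> trm) \<Rightarrow> bool" (infix "\<triangleright>\<^sub>s" 50) where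
  dev_refl: "M \<triangleright> M"
| dev_Lam: "M \<triangleright> M' \<Longrightarrow> Lam p M \<triangleright> Lam p M'"
| dev_App: "M \<triangleright> M' \<Longrightarrow> N \<triangleright> N' \<Longrightarrow> M \<cdot> N \<triangleright> M' \<cdot> N'"
| dev_beta: "M \<triangleright> M' \<Longrightarrow> matches p \<theta> N \<Longrightarrow> \<theta> \<triangleright>\<^sub>s \<theta>' \<Longrightarrow> Lam p M \<cdot> N \<triangleright> subst \<theta>' M'"
| devs: "sdom \<theta> = sdom \<theta>' \<Longrightarrow> \<forall>x \<in> sdom \<theta>. \<theta> x \<triangleright> \<theta>' x \<Longrightarrow> \<theta> \<triangleright>\<^sub>s \<theta>'"

text \<open>\<open>hpat p M M'\<close> is the relation \<open>M \<leadsto>\<^sub>p M'\<close>. In \<open>hstep_arg\<close> the first premise is the convention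
  that in \<open>Lam p M \<cdot> N\<close> the variables of \<open>p\<close> do not occur free in \<open>N\<close>; in \<open>hstep_beta\<close> and
  \<open>dev_beta\<close> it is implied by \<open>matches\<close>.\<close>

inductive hstep :: "trm \<Rightarrow> trm \<Rightarrow> bool" (infix "\<rightarrow>\<^sub>h" 50)
  and hpat :: "var pat \<Rightarrow> trm \<Rightarrow> trm \<Rightarrow> bool" where
  hstep_App: "M \<rightarrow>\<^sub>h M' \<Longrightarrow> M \<cdot> N \<rightarrow>\<^sub>h M' \<cdot> N"
| hstep_beta: "matches p \<theta> N \<Longrightarrow> Lam p M \<cdot> N \<rightarrow>\<^sub>h subst \<theta> M"
| hstep_arg: "pvars p \<inter> FV N = {} \<Longrightarrow> hpat p N N' \<Longrightarrow> Lam p M \<cdot> N \<rightarrow>\<^sub>h Lam p M \<cdot> N'"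
| hpat_hstep: "M \<rightarrow>\<^sub>h M' \<Longrightarrow> hpat (PData d) M M'"
| hpat_left: "hpat (PData d) D D' \<Longrightarrow> data_term D \<Longrightarrow> data_term D'
    \<Longrightarrow> hpat (PData (PApp d p)) (D \<cdot> M) (D' \<cdot> M)"
| hpat_right: "hpat p M M' \<Longrightarrow> matches (PData d) \<theta> D \<Longrightarrow> data_term D
    \<Longrightarrow> hpat (PData (PApp d p)) (D \<cdot> M) (D \<cdot> M')"

inductive standard :: "trm list \<Rightarrow> bool" where
  StdVar: "standard [Var x]"
| StdCon: "standard [Con c]"
| StdHead: "standard (M\<^sub>2 # Ms) \<Longrightarrow> M\<^sub>1 \<rightarrow>\<^sub>h M\<^sub>2 \<Longrightarrow> standard (M\<^sub>1 # M\<^sub>2 # Ms)"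
| StdAbs: "standard Ms \<Longrightarrow> standard (map (Lam p) Ms)"
| StdApp: "standard Ms \<Longrightarrow> standard Ns
    \<Longrightarrow> standard (map (\<lambda>M. M \<cdot> hd Ns) Ms @ map (\<lambda>N. last Ms \<cdot> N) (tl Ns))"

end

theory Submission
  imports Defs
begin

text \<open>Following Kashima, let \<open>st L N\<close> mean that head steps lead from \<open>L\<close> to a term with the outermost
  constructor of \<open>N\<close> whose immediate subterms are again related by \<open>st\<close> to those of \<open>N\<close>. Such a pair
  is joined by a standard sequence, and \<open>st\<close> is reflexive, so it suffices that \<open>st L M\<close> and \<open>M \<triangleright> N\<close>
  imply \<open>st L N\<close>. The crucial case is a contracted redex: if \<open>p\<close> matches \<open>N\<close> and \<open>st L N\<close>, then steps
  \<open>hpat p\<close> lead from \<open>L\<close> to a term that \<open>p\<close> matches as well, with a substitution pointwise related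
  by \<open>st\<close>.\<close>

section \<open>Substitution on terms modulo alpha-conversion\<close>

text \<open>Every term is the class of a raw term. No freshness of \<open>p\<close> is provided, so
  inductions that need it rename the binder explicitly.\<close>

lemma trm_induct [case_names Var Con Lam App]:
  assumes "\<And>x. P (Var x)" "\<And>c. P (Con c)" "\<And>p M. P M \<Longrightarrow> P (Lam p M)"
    "\<And>M N. P M \<Longrightarrow> P N \<Longrightarrow> P (M \<cdot> N)"
  shows "P M"
proof -
  have "P (abs_trm R)" for R
    by (induction R) (use assms in \<open>simp_all flip: Var.abs_eq Con.abs_eq Lam.abs_eq App.abs_eq\<close>)
  then show ?thesis by (metis Quotient_abs_rep[OF Quotient_trm])
qed

lemma trm_distinct [simp]:
  "Var x \<noteq> Con c" "Var x \<noteq> Lam p M" "Var x \<noteq> M \<cdot> N" "Con c \<noteq> Lam p M" "Con c \<noteq> M \<cdot> N"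
  "Lam p K \<noteq> M \<cdot> N"
  "Con c \<noteq> Var x" "Lam p M \<noteq> Var x" "M \<cdot> N \<noteq> Var x" "Lam p M \<noteq> Con c" "M \<cdot> N \<noteq> Con c"
  "M \<cdot> N \<noteq> Lam p K"
  by (transfer, auto elim: alpha.cases)+

lemma trm_inject [simp]:
  "Var x = Var y \<longleftrightarrow> x = y" "Con c = Con c' \<longleftrightarrow> c = c'"
  "M \<cdot> N = M' \<cdot> N' \<longleftrightarrow> M = M' \<and> N = N'"
  by (transfer, auto elim: alpha.cases intro: alpha.intros)+

lemma finite_FV [simp]: "finite (FV M)"
  by transfer simp

lemma FV_subst: "FV (subst \<theta> M) = (\<Union>x \<in> FV M. FV (\<theta> x))"
  by transfer (rule rfv_rsubst)

lemma subst_cong: "(\<And>x. x \<in> FV M \<Longrightarrow> \<theta> x = \<theta>' x) \<Longrightarrow> subst \<theta> M = subst \<theta>' M"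
  by transfer (simp add: rsubst_cong)

lemma subst_Var [simp]: "subst Var M = M"
  by (induction M rule: trm_induct) (auto simp: subst_Lam)

text \<open>The shift built into \<open>rsubst\<close> is one choice of fresh names among many; by
  \<open>rsubst_Lam_alpha\<close> any other gives an alpha-equivalent abstraction, so names can be
  chosen to suit all terms in play.\<close>

lemma subst_Lam_rename:
  assumes "inj_on f (pvars p)" "\<And>y. y \<in> FV M - pvars p \<Longrightarrow> FV (\<theta> y) \<inter> f ` pvars p = {}"
  shows "subst \<theta> (Lam p M) =
    Lam (map_pat f p) (subst (\<lambda>x. if x \<in> pvars p then Var (f x) else \<theta> x) M)"
  using assms
proof transfer
  fix f p and \<theta> :: "var \<Rightarrow> var rtrm" and M
  assume *: "inj_on f (pvars p)" "\<And>y. y \<in> rfv M - pvars p \<Longrightarrow> rfv (\<theta> y) \<inter> f ` pvars p = {}"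
  let ?k = "fresh_above (\<Union>y \<in> rfv M - pvars p. rfv (\<theta> y))"
  have k: "z < ?k" if "z \<in> rfv (\<theta> y)" "y \<in> rfv M" "y \<notin> pvars p" for y z
    using that by (auto intro!: fresh_above)
  show "alpha (rsubst \<theta> (RLam p M))
    (RLam (map_pat f p) (rsubst (\<lambda>x. if x \<in> pvars p then RVar (f x) else \<theta> x) M))"
    unfolding rsubst.simps Let_def
  proof (rule rsubst_Lam_alpha[OF map_rsubst])
    show "\<forall>x\<in>rfv M - pvars p. rfv (if x \<in> pvars p then RVar (x + ?k) else \<theta> x) \<inter>
      ((\<lambda>x. x + ?k) ` pvars p \<union> f ` pvars p) = {}"
      using *(2) k by fastforce
  qed (use *(1) in \<open>auto simp: inj_on_def intro: alpha_refl\<close>)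
qed

lemma Lam_eq_rename:
  assumes "inj_on f (pvars p)" "(FV M - pvars p) \<inter> f ` pvars p = {}"
  shows "Lam p M = Lam (map_pat f p) (subst (\<lambda>x. if x \<in> pvars p then Var (f x) else Var x) M)"
  using subst_Lam_rename[of f p M Var] assms by auto

lemma Lam_eqD:
  assumes "Lam p M = Lam q N"
  obtains f where "bij f" "q = map_pat f p" "\<forall>x \<in> FV M - pvars p. f x = x"
    "N = subst (\<lambda>x. Var (f x)) M"
proof -
  have "\<exists>f. bij f \<and> q = map_pat f p \<and> (\<forall>x \<in> FV M - pvars p. f x = x) \<and> N = subst (\<lambda>x. Var (f x)) M"
    using assms
  proof transfer
    fix p q and M N :: "var rtrm"
    assume "alpha (RLam p M) (RLam q N)"
    then obtain f where f: "bij f" "q = map_pat f p" "\<forall>x \<in> rfv M - pvars p. f x = x"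
      "alpha (map_rtrm f M) N" by (auto elim: alpha_LamE)
    \<comment> \<open>\<open>map_rsubst\<close> pushes a renaming into a substitution, so
      \<open>M\<close> is first presented as its own identity instance.\<close>
    have "alpha (rsubst RVar M) M" by (rule subst_Var[untransferred])
    then have "alpha (map_rtrm f (rsubst RVar M)) (map_rtrm f M)"
      using f(1) by (rule alpha_map)
    moreover have "alpha (map_rtrm f (rsubst RVar M)) (rsubst (\<lambda>x. RVar (f x)) M)"
      using map_rsubst[OF f(1), of RVar M] by simp
    ultimately have "alpha N (rsubst (\<lambda>x. RVar (f x)) M)"
      using f(4) by (blast intro: alpha_sym alpha_trans)
    then show "\<exists>f. bij f \<and> q = map_pat f p \<and> (\<forall>x \<in> rfv M - pvars p. f x = x) \<and>
      alpha N (rsubst (\<lambda>x. RVar (f x)) M)" using f by blast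
  qed
  then show ?thesis using that by blast
qed

lemma obtain_fresh:
  assumes "finite B"
  obtains f :: "var \<Rightarrow> var" where "inj f" "range f \<inter> B = {}"
proof
  show "inj (\<lambda>x. x + fresh_above B)" by (simp add: inj_def)
  show "range (\<lambda>x. x + fresh_above B) \<inter> B = {}"
    by (auto dest: fresh_above[OF assms])
qed

lemma subst_subst: "subst \<sigma> (subst \<theta> M) = subst (\<lambda>x. subst \<sigma> (\<theta> x)) M"
proof (induction M arbitrary: \<sigma> \<theta> rule: trm_induct)
  case (Lam p M)
  \<comment> \<open>Names outside \<open>?F\<close> let \<open>\<theta>\<close> pass the binder;
    names outside \<open>?G\<close> do so for \<open>\<sigma>\<close> and the composite.\<close>
  let ?F = "\<Union>y \<in> FV M. FV (\<theta> y)" let ?G = "\<Union>y \<in> ?F. FV (\<sigma> y)"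
  obtain f :: "var \<Rightarrow> var" where f: "inj f" "range f \<inter> (?F \<union> ?G) = {}"
    by (rule obtain_fresh[of "?F \<union> ?G"]) (simp, rule that)
  define q where "q = map_pat f p"
  have q: "pvars q = f ` pvars p" by (simp add: q_def pat.set_map)
  have inj: "inj_on f (pvars p)" using f(1) by (rule inj_on_subset) simp
  let ?\<theta> = "\<lambda>x. if x \<in> pvars p then Var (f x) else \<theta> x"
  let ?\<sigma> = "\<lambda>x. if x \<in> pvars q then Var x else \<sigma> x"
  have "subst \<sigma> (subst \<theta> (Lam p M)) = subst \<sigma> (Lam q (subst ?\<theta> M))"
    unfolding q_def using f by (subst subst_Lam_rename[OF inj]) blast+
  also have "\<dots> = Lam (map_pat (\<lambda>x. x) q) (subst ?\<sigma> (subst ?\<theta> M))"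
    using f(2) by (subst subst_Lam_rename[of "\<lambda>x. x"]) (auto simp: FV_subst q split: if_splits)
  also have "subst ?\<sigma> (subst ?\<theta> M) = subst (\<lambda>x. subst ?\<sigma> (?\<theta> x)) M"
    by (rule Lam.IH)
  also have "\<dots> = subst (\<lambda>x. if x \<in> pvars p then Var (f x) else subst \<sigma> (\<theta> x)) M"
    using f(2) by (intro subst_cong) (auto simp: q intro!: subst_cong; blast)
  also have "Lam (map_pat (\<lambda>x. x) q) \<dots> = subst (\<lambda>x. subst \<sigma> (\<theta> x)) (Lam p M)"
    using f(2) by (subst subst_Lam_rename[OF inj]) (auto simp: FV_subst q_def pat.map_ident)
  finally show ?case .
qed simp_all

text \<open>Contraction of a beta-redex commutes with a substitution \<open>\<sigma>\<close>; \<open>\<tau>\<close> is the image under \<open>\<sigma>\<close> of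
  the matching substitution \<open>\<theta>\<close>, for the binder renamed by \<open>f\<close>.\<close>

lemma subst_beta:
  assumes "\<And>x. x \<in> A \<Longrightarrow> \<tau> (f x) = subst \<sigma> (\<theta> x)" "\<And>y. y \<notin> f ` A \<Longrightarrow> \<tau> y = Var y"
    "\<And>x. x \<notin> A \<Longrightarrow> \<theta> x = Var x" "\<And>x. x \<in> FV M - A \<Longrightarrow> FV (\<sigma> x) \<inter> f ` A = {}"
  shows "subst \<tau> (subst (\<lambda>x. if x \<in> A then Var (f x) else \<sigma> x) M) = subst \<sigma> (subst \<theta> M)"
proof -
  have "subst \<tau> (\<sigma> x) = \<sigma> x" if "x \<in> FV M - A" for x
    using subst_cong[of "\<sigma> x" \<tau> Var] assms(2,4) that by (metis disjoint_iff subst_Var)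
  then show ?thesis unfolding subst_subst using assms by (intro subst_cong) auto
qed

section \<open>Matching\<close>

text \<open>Since \<open>x \<notin> FV N\<close> in \<open>match_Var\<close>, \<open>N\<close>
  differs from \<open>Var x\<close> and no variable drops out of the domain. Disjoint domains in
  \<open>match_App\<close> thus mean that the subpatterns share no variable.\<close>

lemma matches_sdom: "matches p \<theta> M \<Longrightarrow> sdom \<theta> = pvars p"
proof (induction rule: matches.induct)
  case (match_App d p D N \<theta>\<^sub>1 \<theta>\<^sub>2)
  then show ?case by (auto simp: sdom_def sunion_def)
qed (auto simp: sdom_def)

lemma matches_outside: "matches p \<theta> M \<Longrightarrow> x \<notin> pvars p \<Longrightarrow> \<theta> x = Var x"
  using matches_sdom by (force simp: sdom_def)

lemma matches_FV: "matches p \<theta> M \<Longrightarrow> x \<in> pvars p \<Longrightarrow> FV (\<theta> x) \<subseteq> FV M"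
  by (induction arbitrary: x rule: matches.induct) (fastforce simp: sunion_def matches_sdom split: if_splits)+

lemma matches_data: "matches (PData d) \<theta> M \<Longrightarrow> data_term M"
  by (erule matches.cases) (auto intro: data_term.intros)

lemma data_term_App [simp]: "data_term (D \<cdot> M) \<longleftrightarrow> data_term D"
  using data_term.cases[of "D \<cdot> M"] by (auto intro: data_term.intros)

lemma data_term_subst: "data_term D \<Longrightarrow> data_term (subst \<sigma> D)"
  by (induction rule: data_term.induct) (auto intro: data_term.intros)

text \<open>Pattern variables must stay apart from the matched term, so \<open>f\<close> renames
  them while \<open>\<sigma>\<close> acts. The hypotheses determine \<open>\<tau>\<close>
  completely, which lets the induction restrict it to subpatterns.\<close>

lemma matches_subst:
  assumes "matches p \<theta> M" "inj_on f (pvars p)" "f ` pvars p \<inter> FV (subst \<sigma> M) = {}"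
    "\<And>x. x \<in> pvars p \<Longrightarrow> \<tau> (f x) = subst \<sigma> (\<theta> x)" "\<And>y. y \<notin> f ` pvars p \<Longrightarrow> \<tau> y = Var y"
  shows "matches (map_pat f p) \<tau> (subst \<sigma> M)"
  using assms
proof (induction arbitrary: \<tau> rule: matches.induct)
  case (match_Var x N)
  have \<tau>: "\<tau> = Var(f x := subst \<sigma> N)" using match_Var by auto
  show ?case using match_Var matches.match_Var[of "f x" "subst \<sigma> N"]
    unfolding \<tau> by (simp add: fun_upd_def)
next
  case (match_Con c)
  then have "\<tau> = Var" by auto
  then show ?case by (simp add: matches.match_Con)
next
  case (match_App d p D N \<theta>\<^sub>1 \<theta>\<^sub>2)
  define \<tau>1 where "\<tau>1 x = (if x \<in> f ` set_dpat d then \<tau> x else Var x)" for x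
  define \<tau>2 where "\<tau>2 x = (if x \<in> f ` pvars p then \<tau> x else Var x)" for x
  have dom: "sdom \<theta>\<^sub>1 = set_dpat d" "sdom \<theta>\<^sub>2 = pvars p"
    using matches_sdom match_App.hyps by fastforce+
  have disj: "f ` set_dpat d \<inter> f ` pvars p = {}"
    using match_App.hyps(5) match_App.prems(1) unfolding dom by (auto simp: inj_on_def)
  have 1: "matches (map_pat f (PData d)) \<tau>1 (subst \<sigma> D)"
    using match_App.prems
    by (intro match_App.IH(1)) (auto simp: \<tau>1_def sunion_def dom inj_on_def)
  have 2: "matches (map_pat f p) \<tau>2 (subst \<sigma> N)"
    using match_App.prems(1,2,3) match_App.hyps(5)
    by (intro match_App.IH(2)) (auto simp: \<tau>2_def sunion_def dom inj_on_def)
  have "\<tau> x = sunion \<tau>1 \<tau>2 x" for x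
    using match_App.prems(4) matches_sdom[OF 1]
    by (auto simp: sunion_def \<tau>1_def \<tau>2_def dpat.set_map image_Un)
  then have "\<tau> = sunion \<tau>1 \<tau>2" ..
  moreover have "matches (PData (PApp (map_dpat f d) (map_pat f p))) (sunion \<tau>1 \<tau>2) (subst \<sigma> D \<cdot> subst \<sigma> N)"
  proof (rule matches.match_App)
    show "sdom \<tau>1 \<inter> sdom \<tau>2 = {}"
      using disj by (simp add: matches_sdom[OF 1] matches_sdom[OF 2] pat.set_map dpat.set_map)
    show "pvars (PData (PApp (map_dpat f d) (map_pat f p))) \<inter> FV (subst \<sigma> D \<cdot> subst \<sigma> N) = {}"
      using match_App.prems(2) by (simp add: pat.set_map dpat.set_map image_Un)
  qed (use 1 2 match_App.hyps(2) in \<open>auto intro: data_term_subst\<close>)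
  ultimately show ?case by simp
qed

lemma matches_substE:
  assumes "matches p \<theta> M" "inj f" "f ` pvars p \<inter> FV (subst \<sigma> M) = {}"
  obtains \<tau> where "matches (map_pat f p) \<tau> (subst \<sigma> M)"
    "\<And>x. x \<in> pvars p \<Longrightarrow> \<tau> (f x) = subst \<sigma> (\<theta> x)" "\<And>y. y \<notin> f ` pvars p \<Longrightarrow> \<tau> y = Var y"
proof -
  let ?\<tau> = "\<lambda>y. if y \<in> f ` pvars p then subst \<sigma> (\<theta> (inv f y)) else Var y"
  have \<tau>: "?\<tau> (f x) = subst \<sigma> (\<theta> x)" if "x \<in> pvars p" for x using assms(2) that by simp
  have "matches (map_pat f p) ?\<tau> (subst \<sigma> M)"
    using assms \<tau> by (intro matches_subst[OF assms(1)]) (auto intro: inj_on_subset)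
  then show ?thesis using that \<tau> by auto
qed

section \<open>Head steps\<close>

lemma FV_subst_matches:
  assumes "matches p \<theta> N"
  shows "FV (subst \<theta> M) \<subseteq> (FV M - pvars p) \<union> FV N"
proof -
  have "FV (\<theta> x) \<subseteq> (if x \<in> pvars p then FV N else {x})" for x
    using matches_FV[OF assms, of x] matches_outside[OF assms, of x] by auto
  then show ?thesis by (fastforce simp: FV_subst split: if_splits)
qed

text \<open>Serves to carry the freshness of pattern variables along reduction sequences.\<close>

lemma hstep_hpat_FV:
  "M \<rightarrow>\<^sub>h M' \<Longrightarrow> FV M' \<subseteq> FV M"
  "hpat p M M' \<Longrightarrow> FV M' \<subseteq> FV M"
  by (induction rule: hstep_hpat.inducts) (use FV_subst_matches in fastforce)+

lemma hsteps_FV: "hstep\<^sup>*\<^sup>* M M' \<Longrightarrow> FV M' \<subseteq> FV M"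
  by (induction rule: rtranclp_induct) (use hstep_hpat_FV(1) in blast)+

lemma hpats_FV: "(hpat p)\<^sup>*\<^sup>* M M' \<Longrightarrow> FV M' \<subseteq> FV M"
  by (induction rule: rtranclp_induct) (use hstep_hpat_FV(2) in blast)+

text \<open>Matching survives substitution once the pattern variables have fresh names. The second
  claim leaves the renaming \<open>f\<close> open so that \<open>hstep_arg\<close> can choose it for
  its binder.\<close>

lemma hstep_hpat_subst:
  "M \<rightarrow>\<^sub>h M' \<Longrightarrow> subst \<sigma> M \<rightarrow>\<^sub>h subst \<sigma> M'"
  "hpat p M M' \<Longrightarrow> inj f \<Longrightarrow> f ` pvars p \<inter> FV (subst \<sigma> M) = {} \<Longrightarrow>
    hpat (map_pat f p) (subst \<sigma> M) (subst \<sigma> M')"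
proof (induction arbitrary: \<sigma> and \<sigma> f rule: hstep_hpat.inducts)
  case (hstep_App M M' N)
  then show ?case by (simp add: hstep_hpat.hstep_App)
next
  case (hstep_beta p \<theta> N M)
  let ?B = "(\<Union>y \<in> FV M. FV (\<sigma> y)) \<union> FV (subst \<sigma> N)"
  obtain f :: "var \<Rightarrow> var" where f: "inj f" "range f \<inter> ?B = {}"
    by (rule obtain_fresh[of ?B]) (simp, rule that)
  obtain \<tau> where \<tau>: "matches (map_pat f p) \<tau> (subst \<sigma> N)"
    "\<And>x. x \<in> pvars p \<Longrightarrow> \<tau> (f x) = subst \<sigma> (\<theta> x)" "\<And>y. y \<notin> f ` pvars p \<Longrightarrow> \<tau> y = Var y"
    using f by (elim matches_substE[OF hstep_beta, of f \<sigma>]) blast+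
  let ?\<sigma> = "\<lambda>x. if x \<in> pvars p then Var (f x) else \<sigma> x"
  have "subst \<sigma> (Lam p M) = Lam (map_pat f p) (subst ?\<sigma> M)"
    using f by (intro subst_Lam_rename) (auto intro: inj_on_subset)
  moreover have "subst \<tau> (subst ?\<sigma> M) = subst \<sigma> (subst \<theta> M)"
    using f \<tau> matches_outside[OF hstep_beta] by (intro subst_beta) auto
  ultimately show ?case using hstep_hpat.hstep_beta[OF \<tau>(1)] by (metis subst_simps(3))
next
  case (hstep_arg p N N' M)
  let ?B = "(\<Union>y \<in> FV M. FV (\<sigma> y)) \<union> FV (subst \<sigma> N)"
  obtain f :: "var \<Rightarrow> var" where f: "inj f" "range f \<inter> ?B = {}"
    by (rule obtain_fresh[of ?B]) (simp, rule that)
  have "subst \<sigma> (Lam p M) = Lam (map_pat f p) (subst (\<lambda>x. if x \<in> pvars p then Var (f x) else \<sigma> x) M)"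
    using f by (intro subst_Lam_rename) (auto intro: inj_on_subset)
  moreover have "hpat (map_pat f p) (subst \<sigma> N) (subst \<sigma> N')"
    using f by (intro hstep_arg.IH) auto
  moreover have "pvars (map_pat f p) \<inter> FV (subst \<sigma> N) = {}"
    using f(2) by (auto simp: pat.set_map)
  ultimately show ?case by (simp add: hstep_hpat.hstep_arg)
next
  case (hpat_hstep M M' d)
  then show ?case by (simp add: hstep_hpat.hpat_hstep)
next
  case (hpat_left d D D' p M)
  then have "hpat (map_pat f (PData d)) (subst \<sigma> D) (subst \<sigma> D')"
    by (intro hpat_left.IH) auto
  then show ?case using hpat_left.hyps by (simp add: hstep_hpat.hpat_left data_term_subst)
next
  case (hpat_right p M M' d \<theta> D)
  have "hpat (map_pat f p) (subst \<sigma> M) (subst \<sigma> M')"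
    using hpat_right.prems by (intro hpat_right.IH) auto
  moreover obtain \<tau> where "matches (map_pat f (PData d)) \<tau> (subst \<sigma> D)"
    using hpat_right.prems by (elim matches_substE[OF hpat_right.hyps(2), of f \<sigma>]) auto
  ultimately show ?case using hpat_right.hyps(3)
    by (auto intro: hstep_hpat.hpat_right data_term_subst)
qed

lemma rtranclp_hom:
  assumes "r\<^sup>*\<^sup>* a b" "\<And>x y. r x y \<Longrightarrow> s (f x) (f y)"
  shows "s\<^sup>*\<^sup>* (f a) (f b)"
  using assms(1)
proof (induction rule: rtranclp_induct)
  case (step b c)
  from step.IH assms(2)[OF step.hyps(2)] show ?case by (rule rtranclp.rtrancl_into_rtrancl)
qed simp

lemma hsteps_subst: "hstep\<^sup>*\<^sup>* M M' \<Longrightarrow> hstep\<^sup>*\<^sup>* (subst \<sigma> M) (subst \<sigma> M')"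
  by (erule rtranclp_hom) (rule hstep_hpat_subst(1))

lemma hsteps_App: "hstep\<^sup>*\<^sup>* M M' \<Longrightarrow> hstep\<^sup>*\<^sup>* (M \<cdot> N) (M' \<cdot> N)"
  by (erule rtranclp_hom) (rule hstep_App)

lemma hsteps_arg:
  "(hpat p)\<^sup>*\<^sup>* N N' \<Longrightarrow> pvars p \<inter> FV N = {} \<Longrightarrow> hstep\<^sup>*\<^sup>* (Lam p M \<cdot> N) (Lam p M \<cdot> N')"
proof (induction rule: rtranclp_induct)
  case (step N' N'')
  then have "Lam p M \<cdot> N' \<rightarrow>\<^sub>h Lam p M \<cdot> N''"
    using hpats_FV[OF step.hyps(1)] by (intro hstep_arg) auto
  then show ?case using step by simp
qed simp

lemma hsteps_hpats: "hstep\<^sup>*\<^sup>* M M' \<Longrightarrow> (hpat (PData d))\<^sup>*\<^sup>* M M'"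
  by (erule rtranclp_mono[THEN predicate2D, rotated]) (blast intro: hpat_hstep)

text \<open>The side conditions of \<open>hpat_left\<close> cost nothing: a step that starts or ends outside the data
  terms is a head step, and \<open>hstep_App\<close> applies instead.\<close>

lemma hpat_App_left:
  assumes "hpat (PData d) D D'"
  shows "hpat (PData (PApp d p)) (D \<cdot> M) (D' \<cdot> M)"
proof -
  have "D \<rightarrow>\<^sub>h D' \<or> data_term D \<and> data_term D'"
    using assms by (cases rule: hpat.cases) auto
  then show ?thesis using assms by (auto intro: hstep_App hpat_hstep hpat_left)
qed

lemma hpats_App_left:
  "(hpat (PData d))\<^sup>*\<^sup>* D D' \<Longrightarrow> (hpat (PData (PApp d p)))\<^sup>*\<^sup>* (D \<cdot> M) (D' \<cdot> M)"
  by (erule rtranclp_hom) (rule hpat_App_left)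

lemma hpats_App_right:
  "(hpat p)\<^sup>*\<^sup>* M M' \<Longrightarrow> matches (PData d) \<theta> D \<Longrightarrow>
    (hpat (PData (PApp d p)))\<^sup>*\<^sup>* (D \<cdot> M) (D \<cdot> M')"
  by (erule rtranclp_hom) (blast intro: hpat_right matches_data)

section \<open>Standard reduction as a relation\<close>

inductive st :: "trm \<Rightarrow> trm \<Rightarrow> bool" where
  st_Var: "hstep\<^sup>*\<^sup>* L (Var x) \<Longrightarrow> st L (Var x)"
| st_Con: "hstep\<^sup>*\<^sup>* L (Con c) \<Longrightarrow> st L (Con c)"
| st_Lam: "hstep\<^sup>*\<^sup>* L (Lam p M) \<Longrightarrow> st M M' \<Longrightarrow> st L (Lam p M')"
| st_App: "hstep\<^sup>*\<^sup>* L (M \<cdot> N) \<Longrightarrow> st M M' \<Longrightarrow> st N N' \<Longrightarrow> st L (M' \<cdot> N')"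

lemma st_refl: "st M M"
  by (induction M rule: trm_induct) (auto intro: st.intros)

text \<open>Every rule of \<open>st\<close> begins with a head reduction of the left term, so
  further head steps can be put in front.\<close>

lemma hsteps_st:
  assumes "hstep\<^sup>*\<^sup>* L M" "st M N"
  shows "st L N"
proof -
  have "hstep\<^sup>*\<^sup>* L K" if "hstep\<^sup>*\<^sup>* M K" for K
    using assms(1) that by (rule rtranclp_trans)
  with assms(2) show ?thesis by cases (blast intro: st.intros)+
qed

text \<open>If \<open>L\<close> head-reduces to \<open>Var x\<close>, its instance head-reduces to
  \<open>\<theta> x\<close>, and \<open>hsteps_st\<close> absorbs these steps. Two substitutions are
  needed because matching on both sides of \<open>st\<close> yields only pointwise related
  ones.\<close>

lemma st_subst:
  "st M M' \<Longrightarrow> (\<And>x. st (\<theta> x) (\<theta>' x)) \<Longrightarrow> st (subst \<theta> M) (subst \<theta>' M')"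
proof (induction arbitrary: \<theta> \<theta>' rule: st.induct)
  case (st_Var L x)
  then show ?case using hsteps_st hsteps_subst by fastforce
next
  case (st_Con L c)
  then show ?case using st.st_Con hsteps_subst by fastforce
next
  case (st_Lam L p M M')
  let ?B = "(\<Union>y \<in> FV M. FV (\<theta> y)) \<union> (\<Union>y \<in> FV M'. FV (\<theta>' y))"
  obtain f :: "var \<Rightarrow> var" where f: "inj f" "range f \<inter> ?B = {}"
    by (rule obtain_fresh[of ?B]) (simp, rule that)
  let ?r = "\<lambda>\<theta> x. if x \<in> pvars p then Var (f x) else \<theta> x"
  have eq: "subst \<theta> (Lam p M) = Lam (map_pat f p) (subst (?r \<theta>) M)"
    "subst \<theta>' (Lam p M') = Lam (map_pat f p) (subst (?r \<theta>') M')"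
    using f by (auto intro!: subst_Lam_rename intro: inj_on_subset)
  have "st (subst (?r \<theta>) M) (subst (?r \<theta>') M')"
    using st_Lam.prems by (intro st_Lam.IH) (auto intro: st_refl)
  then show ?case using hsteps_subst[OF st_Lam.hyps(1), of \<theta>] unfolding eq
    by (intro st.st_Lam)
next
  case (st_App L M N M' N')
  then show ?case using hsteps_subst[OF st_App.hyps(1), of \<theta>] by (auto intro: st.st_App)
qed

section \<open>Inversion of \<open>st\<close> and closure under developments\<close>

lemma st_AppE:
  assumes "st L (M' \<cdot> N')"
  obtains M N where "hstep\<^sup>*\<^sup>* L (M \<cdot> N)" "st M M'" "st N N'"
  using assms by (auto elim: st.cases)

text \<open>Inversion yields some alpha-variant with binder \<open>q\<close>. As \<open>p\<close> is
  fresh for \<open>L\<close>, it is fresh for its head reduct, which can therefore be given the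
  binder \<open>p\<close> too.\<close>

lemma st_LamE:
  assumes "st L (Lam p M')" "pvars p \<inter> FV L = {}"
  obtains M where "hstep\<^sup>*\<^sup>* L (Lam p M)" "st M M'"
  using assms(1)
proof (cases rule: st.cases)
  case (st_Lam q K K')
  obtain f where f: "bij f" "p = map_pat f q" "\<forall>x \<in> FV K' - pvars q. f x = x"
    "M' = subst (\<lambda>x. Var (f x)) K'"
    using st_Lam(1)[symmetric] by (rule Lam_eqD)
  \<comment> \<open>\<open>f\<close> is known to fix the free variables of \<open>Lam q K'\<close>
    only, and \<open>Lam q K\<close> may have others; so only the variables of \<open>q\<close> are
    renamed.\<close>
  let ?r = "\<lambda>x. if x \<in> pvars q then Var (f x) else Var x"
  have "inj_on f (pvars q)" using f(1) by (meson bij_def inj_on_subset subset_UNIV)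
  moreover have "(FV K - pvars q) \<inter> f ` pvars q = {}"
    using hsteps_FV[OF st_Lam(2)] assms(2) by (auto simp: f(2) pat.set_map)
  ultimately have "Lam q K = Lam p (subst ?r K)"
    unfolding f(2) by (rule Lam_eq_rename)
  moreover have "M' = subst ?r K'" unfolding f(4) using f(3) by (intro subst_cong) auto
  ultimately show ?thesis
    using that st_Lam(2,3) by (metis (no_types, lifting) st_subst st_refl)
qed auto

text \<open>A variable accepts \<open>L\<close> as it is, and a constant needs only head steps. For
  \<open>PApp\<close>, head steps expose an application, then its function is reduced until
  \<open>d\<close> matches, then its argument; \<open>hpat_right\<close> enforces this
  order.\<close>

lemma st_matches:
  assumes "matches p \<theta> N" "st L N" "pvars p \<inter> FV L = {}"
  shows "\<exists>L' \<theta>'. (hpat p)\<^sup>*\<^sup>* L L' \<and> matches p \<theta>' L' \<and> (\<forall>x. st (\<theta>' x) (\<theta> x))"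
  using assms
proof (induction arbitrary: L rule: matches.induct)
  case (match_Var x N)
  then have "matches (PVar x) (Var(x := L)) L" by (intro matches.match_Var) auto
  moreover have "st ((Var(x := L)) y) ((Var(x := N)) y)" for y
    using match_Var.prems(1) by (simp add: st_refl)
  ultimately show ?case by blast
next
  case (match_Con c)
  then have "hstep\<^sup>*\<^sup>* L (Con c)" by (auto elim: st.cases)
  then show ?case using matches.match_Con st_refl hsteps_hpats by blast
next
  case (match_App d p D N \<theta>\<^sub>1 \<theta>\<^sub>2)
  obtain L1 L2 where L: "hstep\<^sup>*\<^sup>* L (L1 \<cdot> L2)" "st L1 D" "st L2 N"
    using match_App.prems(1) by (rule st_AppE)
  have fresh: "set_dpat d \<inter> FV L1 = {}" "pvars p \<inter> FV L2 = {}" "set_dpat d \<inter> FV L2 = {}"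
    "pvars p \<inter> FV L1 = {}"
    using match_App.prems(2) hsteps_FV[OF L(1)] by auto
  obtain D' \<theta>1 where D': "(hpat (PData d))\<^sup>*\<^sup>* L1 D'" "matches (PData d) \<theta>1 D'" "\<forall>x. st (\<theta>1 x) (\<theta>\<^sub>1 x)"
    using match_App.IH(1)[OF L(2)] fresh by auto
  obtain N' \<theta>2 where N': "(hpat p)\<^sup>*\<^sup>* L2 N'" "matches p \<theta>2 N'" "\<forall>x. st (\<theta>2 x) (\<theta>\<^sub>2 x)"
    using match_App.IH(2)[OF L(3)] fresh by auto
  \<comment> \<open>The domains are the variables of the subpatterns, so disjointness and the case
    split in \<open>sunion\<close> agree on both sides.\<close>
  have dom: "sdom \<theta>1 = sdom \<theta>\<^sub>1" "sdom \<theta>2 = sdom \<theta>\<^sub>2"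
    using matches_sdom D'(2) N'(2) match_App.hyps by metis+
  have "(hpat (PData (PApp d p)))\<^sup>*\<^sup>* L (D' \<cdot> N')"
    using hsteps_hpats[OF L(1)] hpats_App_left[OF D'(1)] hpats_App_right[OF N'(1) D'(2)]
    by (meson rtranclp_trans)
  moreover have "matches (PData (PApp d p)) (sunion \<theta>1 \<theta>2) (D' \<cdot> N')"
    using D'(2) N'(2) match_App.hyps(5) fresh hpats_FV[OF D'(1)] hpats_FV[OF N'(1)]
    by (intro matches.match_App) (auto simp: dom intro: matches_data)
  moreover have "st (sunion \<theta>1 \<theta>2 x) (sunion \<theta>\<^sub>1 \<theta>\<^sub>2 x)" for x
    using D'(3) N'(3) by (simp add: sunion_def dom)
  ultimately show ?case by blast
qed

text \<open>The statement is closed under substitution by \<open>\<rho>\<close> so that binders can be renamed away from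
  the free variables of \<open>L\<close>, of which there may be more than in \<open>M\<close>.\<close>

lemma st_dev_subst:
  "M \<triangleright> N \<Longrightarrow> st L (subst \<rho> M) \<Longrightarrow> st L (subst \<rho> N)"
  "\<theta> \<triangleright>\<^sub>s \<theta>' \<Longrightarrow> st L (subst \<rho> (\<theta> x)) \<Longrightarrow> st L (subst \<rho> (\<theta>' x))"
proof (induction arbitrary: L \<rho> and L \<rho> x rule: dev_devs.inducts)
  case (dev_Lam M M' p)
  let ?B = "(\<Union>y \<in> FV M. FV (\<rho> y)) \<union> (\<Union>y \<in> FV M'. FV (\<rho> y)) \<union> FV L"
  obtain f :: "var \<Rightarrow> var" where f: "inj f" "range f \<inter> ?B = {}"
    by (rule obtain_fresh[of ?B]) (simp, rule that)
  let ?\<rho> = "\<lambda>x. if x \<in> pvars p then Var (f x) else \<rho> x"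
  have eq: "subst \<rho> (Lam p M) = Lam (map_pat f p) (subst ?\<rho> M)"
    "subst \<rho> (Lam p M') = Lam (map_pat f p) (subst ?\<rho> M')"
    using f by (auto intro!: subst_Lam_rename intro: inj_on_subset)
  have "pvars (map_pat f p) \<inter> FV L = {}" using f(2) by (auto simp: pat.set_map)
  then obtain K where "hstep\<^sup>*\<^sup>* L (Lam (map_pat f p) K)" "st K (subst ?\<rho> M)"
    using dev_Lam.prems unfolding eq by (elim st_LamE)
  then show ?case unfolding eq by (blast intro: st_Lam dev_Lam.IH)
next
  case (dev_App M M' N N')
  then show ?case by (auto elim!: st_AppE intro: st_App)
next
  case (dev_beta M M' p \<theta> N \<theta>')
  \<comment> \<open>Avoiding \<open>FV L\<close> keeps the new binder fresh for all head reducts of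
    \<open>L\<close>, as \<open>st_LamE\<close>, \<open>st_matches\<close> and
    \<open>hsteps_arg\<close> require.\<close>
  let ?B = "(\<Union>y \<in> FV M. FV (\<rho> y)) \<union> (\<Union>y \<in> FV M'. FV (\<rho> y)) \<union> FV L \<union> FV (subst \<rho> N)"
  obtain f :: "var \<Rightarrow> var" where f: "inj f" "range f \<inter> ?B = {}"
    by (rule obtain_fresh[of ?B]) (simp, rule that)
  define q where "q = map_pat f p"
  have q: "pvars q = f ` pvars p" by (simp add: q_def pat.set_map)
  let ?\<rho> = "\<lambda>x. if x \<in> pvars p then Var (f x) else \<rho> x"
  have eq: "subst \<rho> (Lam p M) = Lam q (subst ?\<rho> M)"
    unfolding q_def using f by (auto intro!: subst_Lam_rename intro: inj_on_subset)
  obtain \<tau> where \<tau>: "matches q \<tau> (subst \<rho> N)"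
    "\<And>x. x \<in> pvars p \<Longrightarrow> \<tau> (f x) = subst \<rho> (\<theta> x)" "\<And>y. y \<notin> f ` pvars p \<Longrightarrow> \<tau> y = Var y"
    unfolding q_def using f by (elim matches_substE[OF dev_beta.hyps(2), of f \<rho>]) blast+
  obtain A B where AB: "hstep\<^sup>*\<^sup>* L (A \<cdot> B)" "st A (Lam q (subst ?\<rho> M))" "st B (subst \<rho> N)"
    using dev_beta.prems eq by (auto elim: st_AppE)
  have fresh: "pvars q \<inter> FV A = {}" "pvars q \<inter> FV B = {}"
    using hsteps_FV[OF AB(1)] f(2) unfolding q FV_simps by blast+
  obtain K where K: "hstep\<^sup>*\<^sup>* A (Lam q K)" "st K (subst ?\<rho> M)"
    using AB(2) fresh(1) by (rule st_LamE)
  obtain B' \<kappa> where B': "(hpat q)\<^sup>*\<^sup>* B B'" "matches q \<kappa> B'" "\<forall>x. st (\<kappa> x) (\<tau> x)"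
    using st_matches[OF \<tau>(1) AB(3) fresh(2)] by blast
  \<comment> \<open>Expose the application, turn its function into the abstraction, reduce the
    argument until \<open>q\<close> matches, contract.\<close>
  have "hstep\<^sup>*\<^sup>* L (subst \<kappa> K)"
    using AB(1) hsteps_App[OF K(1), of B] hsteps_arg[OF B'(1) fresh(2), of K]
      hstep_beta[OF B'(2), of K] by (meson rtranclp_trans r_into_rtranclp)
  \<comment> \<open>\<open>\<tau>'\<close> is to \<open>\<theta>'\<close> as \<open>\<tau>\<close>
    is to \<open>\<theta>\<close>; the second induction hypothesis carries \<open>st\<close> from
    one to the other pointwise.\<close>
  moreover define \<tau>' where "\<tau>' y = (if y \<in> f ` pvars p then subst \<rho> (\<theta>' (inv f y)) else Var y)" for y
  have "st (\<kappa> y) (\<tau>' y)" for y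
  proof (cases "y \<in> f ` pvars p")
    case True
    then obtain x where x: "y = f x" "x \<in> pvars p" by blast
    have "st (\<kappa> y) (subst \<rho> (\<theta> x))" using B'(3) \<tau>(2) x by metis
    then have "st (\<kappa> y) (subst \<rho> (\<theta>' x))" by (rule dev_beta.IH(2))
    then show ?thesis using x f(1) by (simp add: \<tau>'_def)
  next
    case False
    then show ?thesis using B'(2) by (simp add: \<tau>'_def matches_outside q st_refl)
  qed
  then have "st (subst \<kappa> K) (subst \<tau>' (subst ?\<rho> M'))"
    using dev_beta.IH(1)[OF K(2)] by (intro st_subst)
  moreover have "\<theta>' x = Var x" if "x \<notin> pvars p" for x
    using dev_beta.hyps(3) matches_sdom[OF dev_beta.hyps(2)] that
    by (auto simp: sdom_def elim!: devs.cases)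
  then have "subst \<tau>' (subst ?\<rho> M') = subst \<rho> (subst \<theta>' M')"
    using f by (intro subst_beta) (auto simp: \<tau>'_def)
  ultimately show ?case using hsteps_st by metis
next
  case (devs \<theta> \<theta>')
  then show ?case by (cases "x \<in> sdom \<theta>") (auto simp: sdom_def)
qed auto

lemma st_dev: "st L M \<Longrightarrow> M \<triangleright> N \<Longrightarrow> st L N"
  using st_dev_subst(1)[of M N L Var] by simp

section \<open>Extraction of standard sequences\<close>

lemma hsteps_standard:
  assumes "hstep\<^sup>*\<^sup>* L M" "standard Ms" "Ms \<noteq> []" "hd Ms = M"
  shows "\<exists>Ls. standard Ls \<and> Ls \<noteq> [] \<and> hd Ls = L \<and> last Ls = last Ms"
  using assms(1)
proof (induction rule: converse_rtranclp_induct)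
  case (step L L')
  then obtain Ls where "standard (L' # Ls)" "last (L' # Ls) = last Ms" by (metis list.collapse)
  then show ?case using step.hyps(1) by (intro exI[of _ "L # L' # Ls"]) (auto intro: StdHead)
qed (use assms in blast)

text \<open>Each constructor of the right term has its own rule of \<open>standard\<close>;
  \<open>hsteps_standard\<close> puts the head reduction in front by repeated
  \<open>StdHead\<close>.\<close>

lemma st_standard: "st L M \<Longrightarrow> \<exists>Ms. standard Ms \<and> Ms \<noteq> [] \<and> hd Ms = L \<and> last Ms = M"
proof (induction rule: st.induct)
  case (st_Var L x)
  then show ?case using hsteps_standard[OF _ StdVar] by fastforce
next
  case (st_Con L c)
  then show ?case using hsteps_standard[OF _ StdCon] by fastforce
next
  case (st_Lam L p M M')
  then obtain Ms where "standard Ms" "Ms \<noteq> []" "hd Ms = M" "last Ms = M'" by blast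
  then show ?case
    using hsteps_standard[OF st_Lam.hyps(1) StdAbs[of Ms p]] by (auto simp: hd_map last_map)
next
  case (st_App L M N M' N')
  then obtain Ms Ns where M: "standard Ms" "Ms \<noteq> []" "hd Ms = M" "last Ms = M'"
    and N: "standard Ns" "Ns \<noteq> []" "hd Ns = N" "last Ns = N'" by blast
  let ?Ks = "map (\<lambda>M. M \<cdot> hd Ns) Ms @ map (\<lambda>N. last Ms \<cdot> N) (tl Ns)"
  \<comment> \<open>If \<open>Ns\<close> is a singleton, the second block is empty; then
    \<open>N = N'\<close> and the first block supplies the last term.\<close>
  have "hd ?Ks = M \<cdot> N" "last ?Ks = M' \<cdot> N'"
    using M N by (cases Ns; auto simp: hd_append hd_map last_append last_map)+
  then show ?case
    using hsteps_standard[OF st_App.hyps(1) StdApp[OF M(1) N(1)]] M(2) by auto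
qed

theorem theorem6p5:
  fixes M N :: trm
  assumes "dev\<^sup>*\<^sup>* M N"
  shows "\<exists>Ms. standard Ms \<and> Ms \<noteq> [] \<and> hd Ms = M \<and> last Ms = N"
proof (rule st_standard)
  show "st M N" using assms
    by (induction rule: rtranclp_induct) (rule st_refl, rule st_dev)
qed

end
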